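(* Let $T\ge 1$ and consider the $T$-periodic linear time-varying Markov jump linear system (LTVPM) $x_{k+1}=\phi_k(\omega_k)x_k$, with mode set $\Omega=\{1,\dots,N\}$, real $n\times n$ matrices $\phi_k(i)=\phi_{k+T}(i)$, and mode transition probabilities $p_{ij}$. The LTVPM is mean square stable if and only if there exist a $T$-periodic sequence $(P_k)_{k\ge0}$ (that is, $P_{k+T}=P_k$) of finite sets of matrices $P_k=(P_k(1),\dots,P_k(N))$, $P_k(i)\in\mathbb{R}^{n\times n}$, and a finite sequence of positive real numbers $\nu_0,\dots,\nu_{T-1}$, such that $P_k(i)\succ0$ for all $i\in\Omega$ and all $k$, $$\nu_kP_k-\mathcal{L}_k(P_{k+1})\succeq 0\qquad\text{for all }k\in\{0,1,\dots,T-1\},$$ and $$\prod_{k=0}^{T-1}\nu_k<1.$$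
   Context: The mode process $(\omega_k)_{k\ge0}$ is a homogeneous Markov chain on $\Omega=\{1,\dots,N\}$ with $p_{ij}=\mathbb{P}(\omega_{k+1}=j\mid\omega_k=i)$. (In the application, $\phi_k(i)=A_k(i)+B_k(i)K_k(i)$ is the closed-loop matrix of $x_{k+1}=A_k(\omega_k)x_k+B_k(\omega_k)u_k$ under $u_k=K_k(\omega_k)x_k$.) Mean square stability (MSS): $\lim_{k\to\infty}\mathbb{E}[\|x_k\|^2]=0$ for every initial state $x_0$ and every initial distribution of $\omega_0$, where $\|\cdot\|$ is the Euclidean norm. For a finite set of $n\times n$ matrices $V=(V(1),\dots,V(N))$ define $\mathcal{E}^i(V)=\sum_{j\in\Omega}p_{ij}V(j)$, $\mathcal{L}_k^i(V)=\phi_k(i)^\top\mathcal{E}^i(V)\phi_k(i)$, and $\mathcal{L}_k(V)=(\mathcal{L}_k^1(V),\dots,\mathcal{L}_k^N(V))$. For matrices, $X\succ0$ (resp. $X\succeq0$) means symmetric positive definite (resp. positive semidefinite). For a finite set of matrices $V$, $V\succeq0$ means $V(i)\succeq0$ for every $i\in\Omega$. *)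

theory Defs
  imports "HOL-Probability.Probability"
begin

text \<open>
  The mode set is a (nonempty) finite type \<open>'m\<close>; \<open>N = CARD('m)\<close> and \<open>n = CARD('n)\<close> are arbitrary.
\<close>

definition stochastic :: "('m::finite \<Rightarrow> 'm \<Rightarrow> real) \<Rightarrow> bool" where
  "stochastic p \<longleftrightarrow> (\<forall>i j. 0 \<le> p i j) \<and> (\<forall>i. (\<Sum>j\<in>UNIV. p i j) = 1)"

text \<open>
  Conditional probabilities are constrained only where the conditioning event has nonzero
  probability, since \<open>cond_prob\<close> is \<open>0\<close> otherwise. The conjuncts after measurability are: the initial
  distribution, the Markov property, and the (time-independent) transition probabilities.
\<close>

definition markov_chain ::
  "'a measure \<Rightarrow> (nat \<Rightarrow> 'a \<Rightarrow> 'm::finite) \<Rightarrow> 'm pmf \<Rightarrow> ('m \<Rightarrow> 'm \<Rightarrow> real) \<Rightarrow> bool" where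
  "markov_chain M \<omega> \<mu> p \<longleftrightarrow>
     prob_space M \<and>
     (\<forall>k. \<omega> k \<in> measurable M (count_space UNIV)) \<and>
     (\<forall>i. \<P>(s in M. \<omega> 0 s = i) = pmf \<mu> i) \<and>
     (\<forall>k h j. \<P>(s in M. \<forall>l\<le>k. \<omega> l s = h l) \<noteq> 0 \<longrightarrow>
        \<P>(s in M. \<omega> (Suc k) s = j \<bar> \<forall>l\<le>k. \<omega> l s = h l) =
        \<P>(s in M. \<omega> (Suc k) s = j \<bar> \<omega> k s = h k)) \<and>
     (\<forall>k i j. \<P>(s in M. \<omega> k s = i) \<noteq> 0 \<longrightarrow>
        \<P>(s in M. \<omega> (Suc k) s = j \<bar> \<omega> k s = i) = p i j)"

primrec state ::
  "(nat \<Rightarrow> 'm \<Rightarrow> real^'n^'n) \<Rightarrow> (nat \<Rightarrow> 'm) \<Rightarrow> real^'n \<Rightarrow> nat \<Rightarrow> real^'n" where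
  "state \<phi> w x0 0 = x0"
| "state \<phi> w x0 (Suc k) = \<phi> k (w k) *v state \<phi> w x0 k"

text \<open>
  \<open>M \<mu>\<close> is the probability measure under which the mode process \<open>\<omega>\<close> has initial
  distribution \<open>\<mu>\<close>.
\<close>

definition mean_square_stable ::
  "('m::finite pmf \<Rightarrow> 'a measure) \<Rightarrow> (nat \<Rightarrow> 'a \<Rightarrow> 'm) \<Rightarrow> (nat \<Rightarrow> 'm \<Rightarrow> real^'n^'n) \<Rightarrow> bool" where
  "mean_square_stable M \<omega> \<phi> \<longleftrightarrow>
     (\<forall>x0 \<mu>. (\<lambda>k. \<integral>s. (norm (state \<phi> (\<lambda>l. \<omega> l s) x0 k))\<^sup>2 \<partial>M \<mu>) \<longlonglongrightarrow> 0)"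

definition pos_def :: "real^'n^'n \<Rightarrow> bool" where
  "pos_def X \<longleftrightarrow> transpose X = X \<and> (\<forall>v. v \<noteq> 0 \<longrightarrow> 0 < v \<bullet> (X *v v))"

definition pos_semidef :: "real^'n^'n \<Rightarrow> bool" where
  "pos_semidef X \<longleftrightarrow> transpose X = X \<and> (\<forall>v. 0 \<le> v \<bullet> (X *v v))"

definition mode_avg ::
  "('m::finite \<Rightarrow> 'm \<Rightarrow> real) \<Rightarrow> ('m \<Rightarrow> real^'n^'n) \<Rightarrow> 'm \<Rightarrow> real^'n^'n" where
  "mode_avg p V i = (\<Sum>j\<in>UNIV. p i j *\<^sub>R V j)"

definition lyap_op ::
  "('m::finite \<Rightarrow> 'm \<Rightarrow> real) \<Rightarrow> (nat \<Rightarrow> 'm \<Rightarrow> real^'n^'n) \<Rightarrow> nat \<Rightarrow>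
    ('m \<Rightarrow> real^'n^'n) \<Rightarrow> 'm \<Rightarrow> real^'n^'n" where
  "lyap_op p \<phi> k V i = transpose (\<phi> k i) ** mode_avg p V i ** \<phi> k i"

end

theory Submission
  imports Defs
begin

text \<open>
  Put \<open>q\<^sub>X(v) = v \<bullet> X v\<close>. Conditioning on the modes up to time \<open>k\<close> gives the identity
  \<open>E q\<^bsub>V(\<omega>\<^sub>k\<^sub>+\<^sub>1)\<^esub>(x\<^sub>k\<^sub>+\<^sub>1) = E q\<^bsub>L\<^sub>k(V)(\<omega>\<^sub>k)\<^esub>(x\<^sub>k)\<close> (\<open>expectation_quad_step\<close>): the operator \<open>L\<^sub>k\<close> is the
  one-step transition operator on mode-dependent quadratic forms. Both directions rest on it.

  Sufficiency. The inequalities say that \<open>a\<^sub>k = E q\<^bsub>P\<^sub>k(\<omega>\<^sub>k)\<^esub>(x\<^sub>k)\<close> satisfies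
  \<open>a\<^sub>k\<^sub>+\<^sub>1 \<le> \<nu>\<^sub>k a\<^sub>k\<close>, so over one period it contracts by the factor \<open>\<Prod>\<nu>\<^sub>k < 1\<close> and tends to 0. By
  periodicity and compactness of the unit sphere the \<open>P\<^sub>k(i)\<close> are uniformly bounded below by a
  positive multiple of the identity, hence \<open>E \<parallel>x\<^sub>k\<parallel>\<^sup>2\<close> tends to 0 as well.

  Necessity. Let \<open>W\<^sub>m\<^sub>,\<^sub>k = L\<^sub>k L\<^sub>k\<^sub>+\<^sub>1 \<dots> L\<^sub>k\<^sub>+\<^sub>m\<^sub>-\<^sub>1(I)\<close> (\<open>propagated\<close> below), whose quadratic form gives
  the expected squared norm after \<open>m\<close> steps from time \<open>k\<close>. Starting the chain from point masses,
  stability makes \<open>W\<^sub>m\<^sub>,\<^sub>0\<close> vanish in the limit; monotonicity of the \<open>L\<^sub>k\<close> and periodicity transfer this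
  to every starting time (\<open>propagated_eventually_small\<close>). So there is one horizon \<open>K \<ge> 1\<close> with
  \<open>W\<^sub>K\<^sub>,\<^sub>k \<preceq> I/2\<close> for all \<open>k < T\<close>. With \<open>\<gamma> = 2\<^bsup>1/K\<^esup> > 1\<close> the truncated, exponentially weighted sum
  \<open>P\<^sub>k = \<Sum>\<^bsub>m<K\<^esub> \<gamma>\<^sup>m W\<^sub>m\<^sub>,\<^sub>k\<close> telescopes:
  \<open>\<gamma> L\<^sub>k(P\<^sub>k\<^sub>+\<^sub>1) = P\<^sub>k - I + \<gamma>\<^sup>K W\<^sub>K\<^sub>,\<^sub>k \<preceq> P\<^sub>k\<close>. Therefore all \<open>\<nu>\<^sub>k\<close> can be taken equal to \<open>1/\<gamma>\<close>.
\<close>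

section \<open>Quadratic forms of matrices\<close>

text \<open>The quadratic form of a matrix, which need not be symmetric.\<close>

definition quad :: "real^'n^'n \<Rightarrow> real^'n \<Rightarrow> real" where
  "quad X v = v \<bullet> (X *v v)"

lemma quad_mat_1 [simp]: "quad (mat 1) v = (norm v)\<^sup>2"
  by (simp add: quad_def power2_norm_eq_inner)

lemma quad_scaleR [simp]: "quad (c *\<^sub>R X) v = c * quad X v"
  by (simp add: quad_def scaleR_matrix_vector_assoc[symmetric])

lemma quad_diff: "quad (X - Y) v = quad X v - quad Y v"
  by (simp add: quad_def matrix_vector_mult_diff_rdistrib inner_diff_right)

lemma quad_add: "quad (X + Y) v = quad X v + quad Y v"
  by (simp add: quad_def matrix_vector_mult_add_rdistrib inner_add_right)

lemma quad_zero [simp]: "quad 0 v = 0"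
  by (simp add: quad_def)

lemma quad_sum: "quad (\<Sum>a\<in>A. X a) v = (\<Sum>a\<in>A. quad (X a) v)"
  by (induction A rule: infinite_finite_induct) (auto simp: quad_add)

lemma quad_vec_scaleR: "quad X (c *\<^sub>R v) = c\<^sup>2 * quad X v"
  by (simp add: quad_def matrix_vector_mult_scaleR power2_eq_square)

lemma continuous_on_quad: "continuous_on S (quad X)"
  unfolding quad_def by (intro continuous_intros)

lemma quad_le_entry_sum: "quad X v \<le> (\<Sum>a\<in>UNIV. \<Sum>b\<in>UNIV. \<bar>X $ a $ b\<bar>) * (norm v)\<^sup>2"
proof -
  have "norm (X *v v) \<le> (\<Sum>a\<in>UNIV. \<Sum>b\<in>UNIV. \<bar>X $ a $ b\<bar>) * norm v"
    using onorm[OF matrix_vector_mul_bounded_linear, of X v] onorm_le_matrix_component_sum[of X]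
    by (meson mult_right_mono norm_ge_zero order_trans)
  then have "norm v * norm (X *v v) \<le> norm v * ((\<Sum>a\<in>UNIV. \<Sum>b\<in>UNIV. \<bar>X $ a $ b\<bar>) * norm v)"
    by (intro mult_left_mono) auto
  then show ?thesis
    using norm_cauchy_schwarz[of v "X *v v"] by (simp add: quad_def power2_eq_square mult_ac)
qed

lemma symmetric_entry_polarization:
  fixes X :: "real^'n^'n"
  assumes "transpose X = X"
  shows "X $ a $ b = (quad X (axis a 1 + axis b 1) - quad X (axis a 1) - quad X (axis b 1)) / 2"
proof -
  have sym: "X $ b $ a = X $ a $ b"
    by (metis assms transpose_def vec_lambda_beta)
  have entry: "axis i 1 \<bullet> (X *v axis j 1) = X $ i $ j" for i j
    by (simp add: matrix_vector_mult_basis inner_axis' column_def)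
  show ?thesis
    by (simp add: quad_def matrix_vector_right_distrib inner_add_left inner_add_right entry sym)
qed

text \<open>
  By polarization, pointwise convergence of quadratic forms is convergence of the matrix entries,
  which is uniform on the unit ball.
\<close>

lemma quad_pointwise_imp_uniform:
  fixes X :: "nat \<Rightarrow> real^'n^'n"
  assumes sym: "\<And>m. transpose (X m) = X m"
    and lim: "\<And>v. (\<lambda>m. quad (X m) v) \<longlonglongrightarrow> 0" and "0 < \<epsilon>"
  shows "\<forall>\<^sub>F m in sequentially. \<forall>v. quad (X m) v \<le> \<epsilon> * (norm v)\<^sup>2"
proof -
  have "(\<lambda>m. X m $ a $ b) \<longlonglongrightarrow> (0 - 0 - 0) / 2" for a b
    unfolding symmetric_entry_polarization[OF sym] by (intro tendsto_intros lim) auto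
  then have entry: "(\<lambda>m. X m $ a $ b) \<longlonglongrightarrow> 0" for a b
    by simp
  have "(\<lambda>m. \<Sum>a\<in>UNIV. \<Sum>b\<in>UNIV. \<bar>X m $ a $ b\<bar>) \<longlonglongrightarrow> 0"
    by (intro tendsto_null_sum tendsto_rabs_zero entry)
  from order_tendstoD(2)[OF this \<open>0 < \<epsilon>\<close>] show ?thesis
  proof eventually_elim
    case (elim m)
    show ?case
      using quad_le_entry_sum[of "X m"] elim
      by (meson less_imp_le mult_right_mono order_trans zero_le_power2)
  qed
qed

lemma pos_def_lower_bound:
  fixes X :: "real^'n^'n"
  assumes "pos_def X"
  obtains c where "0 < c" "\<And>v. c * (norm v)\<^sup>2 \<le> quad X v"
proof -
  have pos: "0 < quad X v" if "v \<noteq> 0" for v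
    using assms that by (simp add: pos_def_def quad_def)
  obtain e :: "real^'n" where "norm e = 1"
    using vector_choose_size zero_le_one by blast
  then have "sphere (0 :: real^'n) 1 \<noteq> {}"
    by (auto intro: exI[of _ e])
  from continuous_attains_inf[OF compact_sphere this continuous_on_quad, of X]
  obtain u where u: "norm u = 1" "\<And>w. norm w = 1 \<Longrightarrow> quad X u \<le> quad X w"
    by auto
  show thesis
  proof
    show "0 < quad X u"
      using u(1) by (intro pos) auto
    fix v
    show "quad X u * (norm v)\<^sup>2 \<le> quad X v"
    proof (cases "v = 0")
      case True
      then show ?thesis by (simp add: quad_def)
    next
      case False
      have "quad X u \<le> quad X ((1 / norm v) *\<^sub>R v)"
        using False by (intro u(2)) simp
      then show ?thesis
        using False by (simp add: quad_vec_scaleR field_simps)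
    qed
  qed
qed

section \<open>The Lyapunov operators\<close>

lemma quad_lyap_op:
  "quad (lyap_op p \<phi> k V i) v = (\<Sum>j\<in>UNIV. p i j * quad (V j) (\<phi> k i *v v))"
proof -
  have adj: "v \<bullet> (transpose A *v w) = (A *v v) \<bullet> w" for A and w
    by (metis dot_lmul_matrix inner_commute transpose_matrix_vector)
  have "quad (lyap_op p \<phi> k V i) v = quad (mode_avg p V i) (\<phi> k i *v v)"
    unfolding quad_def lyap_op_def matrix_vector_mul_assoc[symmetric] by (rule adj)
  then show ?thesis
    by (simp add: mode_avg_def quad_sum)
qed

lemma transpose_scaleR: "transpose (c *\<^sub>R (X :: real^'n^'m)) = c *\<^sub>R transpose X"
  by (simp add: transpose_def vec_eq_iff)

lemma transpose_diff: "transpose (X - Y :: real^'n^'m) = transpose X - transpose Y"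
  by (simp add: transpose_def vec_eq_iff)

lemma transpose_sum: "transpose (\<Sum>a\<in>A. X a :: real^'n^'m) = (\<Sum>a\<in>A. transpose (X a))"
  by (simp add: transpose_def vec_eq_iff)

lemma transpose_lyap_op:
  assumes "\<And>j. transpose (V j) = V j"
  shows "transpose (lyap_op p \<phi> k V i) = lyap_op p \<phi> k V i"
  by (simp add: lyap_op_def mode_avg_def matrix_transpose_mul matrix_mul_assoc transpose_sum
      transpose_scaleR assms)

text \<open>
  \<open>propagated p \<phi> m k i\<close> is the matrix of the quadratic form that sends a state \<open>v\<close> at time \<open>k\<close>, with
  mode \<open>i\<close>, to the expected squared norm of the state \<open>m\<close> steps later. The number of steps comes
  before the starting time because the recursion is on the former.
\<close>

primrec propagated ::
  "('m::finite \<Rightarrow> 'm \<Rightarrow> real) \<Rightarrow> (nat \<Rightarrow> 'm \<Rightarrow> real^'n^'n) \<Rightarrow> nat \<Rightarrow> nat \<Rightarrow> 'm \<Rightarrow> real^'n^'n" where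
  "propagated p \<phi> 0 k = (\<lambda>i. mat 1)"
| "propagated p \<phi> (Suc m) k = lyap_op p \<phi> k (propagated p \<phi> m (Suc k))"

lemma transpose_propagated: "transpose (propagated p \<phi> m k i) = propagated p \<phi> m k i"
proof (induction m arbitrary: k i)
  case (Suc m)
  then show ?case
    by (simp add: transpose_lyap_op)
qed simp

lemma quad_propagated_nonneg:
  assumes "stochastic p"
  shows "0 \<le> quad (propagated p \<phi> m k i) v"
proof (induction m arbitrary: k i v)
  case (Suc m)
  then show ?case
    using assms by (auto simp: quad_lyap_op stochastic_def intro!: sum_nonneg)
qed simp

lemma propagated_periodic:
  assumes "\<And>k i. \<phi> (k + T) i = \<phi> k i"
  shows "propagated p \<phi> m (k + T) = propagated p \<phi> m k"
proof (induction m arbitrary: k)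
  case (Suc m)
  have "propagated p \<phi> m (Suc (k + T)) = propagated p \<phi> m (Suc k)"
    using Suc[of "Suc k"] by simp
  then show ?case
    by (intro ext) (simp add: lyap_op_def assms)
qed simp

text \<open>
  Since the Lyapunov operators are monotone and linear, a bound \<open>c I\<close> on the last \<open>m\<close> of \<open>a + m\<close> steps
  passes through the first \<open>a\<close> steps.
\<close>

lemma quad_propagated_add_le:
  assumes "stochastic p"
    and "\<And>i v. quad (propagated p \<phi> m (k + a) i) v \<le> c * (norm v)\<^sup>2"
  shows "quad (propagated p \<phi> (a + m) k i) v \<le> c * quad (propagated p \<phi> a k i) v"
  using assms(2)
proof (induction a arbitrary: k i v)
  case (Suc a)
  have "quad (propagated p \<phi> (a + m) (Suc k) j) w \<le> c * quad (propagated p \<phi> a (Suc k) j) w" for j w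
    using Suc.prems by (intro Suc.IH) simp
  moreover have "0 \<le> p i j" for j
    using assms(1) by (simp add: stochastic_def)
  ultimately show ?case
    by (auto simp: quad_lyap_op sum_distrib_left mult.left_commute[of c]
        intro!: sum_mono mult_left_mono)
qed simp

text \<open>
  Decay of the propagated identity from time 0 implies decay from every earlier time \<open>j < T\<close>:
  the first \<open>T - j\<close> steps reach time \<open>T\<close>, where the system looks as it does at time 0.
\<close>

lemma propagated_eventually_small:
  fixes p :: "'m::finite \<Rightarrow> 'm \<Rightarrow> real" and \<phi> :: "nat \<Rightarrow> 'm \<Rightarrow> real^'n^'n"
  assumes "stochastic p" and per: "\<And>k i. \<phi> (k + T) i = \<phi> k i"
    and lim: "\<And>i v. (\<lambda>m. quad (propagated p \<phi> m 0 i) v) \<longlonglongrightarrow> 0"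
    and "j < T" "0 < \<epsilon>"
  shows "\<forall>\<^sub>F m in sequentially. \<forall>v. quad (propagated p \<phi> m j i) v \<le> \<epsilon> * (norm v)\<^sup>2"
proof -
  let ?R = "propagated p \<phi> (T - j) j i"
  define B where "B = 1 + (\<Sum>a\<in>UNIV. \<Sum>b\<in>UNIV. \<bar>?R $ a $ b\<bar>)"
  have "0 < B"
    unfolding B_def by (intro add_pos_nonneg sum_nonneg) auto
  have R: "quad ?R v \<le> B * (norm v)\<^sup>2" for v
    using quad_le_entry_sum[of ?R v] by (simp add: B_def distrib_right)
      (metis add.commute add_increasing2 zero_le_power2)
  have "\<forall>\<^sub>F m in sequentially. \<forall>i v. quad (propagated p \<phi> m 0 i) v \<le> \<epsilon> / B * (norm v)\<^sup>2"
    using \<open>0 < \<epsilon>\<close> \<open>0 < B\<close>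
    by (intro eventually_all_finite quad_pointwise_imp_uniform transpose_propagated lim) auto
  then have "\<forall>\<^sub>F m in sequentially. \<forall>v. quad (propagated p \<phi> (m + (T - j)) j i) v \<le> \<epsilon> * (norm v)\<^sup>2"
  proof eventually_elim
    case (elim m)
    have "propagated p \<phi> m (j + (T - j)) = propagated p \<phi> m 0"
      using propagated_periodic[of \<phi> T p m 0, OF per] \<open>j < T\<close> by simp
    then have "quad (propagated p \<phi> ((T - j) + m) j i) v \<le> \<epsilon> / B * quad ?R v" for v
      using elim by (intro quad_propagated_add_le assms(1)) simp
    also have "\<epsilon> / B * quad ?R v \<le> \<epsilon> / B * (B * (norm v)\<^sup>2)" for v
      using R \<open>0 < \<epsilon>\<close> \<open>0 < B\<close> by (intro mult_left_mono) auto
    finally show ?case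
      using \<open>0 < B\<close> by (simp add: add.commute)
  qed
  then show ?thesis
    by (rule eventually_sequentially_seg[THEN iffD1])
qed

section \<open>Expectations along the mode process\<close>

lemma state_cong:
  "(\<And>l. l < k \<Longrightarrow> w l = w' l) \<Longrightarrow> state \<phi> w x0 k = state \<phi> w' x0 k"
  by (induction k) auto

text \<open>
  A function of the modes up to time \<open>k\<close> is a finite linear combination of indicators of path
  events, indexed by the extensional functions on \<open>{..k}\<close>.
\<close>

lemma path_function_expansion:
  fixes w :: "nat \<Rightarrow> 'm::finite" and G :: "(nat \<Rightarrow> 'm) \<Rightarrow> real"
  assumes "\<And>w w'. (\<And>l. l \<le> k \<Longrightarrow> w l = w' l) \<Longrightarrow> G w = G w'"
  shows "G w = (\<Sum>h\<in>{..k} \<rightarrow>\<^sub>E UNIV. G h * of_bool (\<forall>l\<le>k. w l = h l))"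
proof -
  have fin: "finite ({..k} \<rightarrow>\<^sub>E (UNIV :: 'm set))"
    by (intro finite_PiE) auto
  have iff: "(\<forall>l\<le>k. w l = h l) \<longleftrightarrow> h = restrict w {..k}" if "h \<in> {..k} \<rightarrow>\<^sub>E UNIV" for h
  proof
    assume eq: "\<forall>l\<le>k. w l = h l"
    show "h = restrict w {..k}"
      using that eq by (intro PiE_ext[of _ "{..k}" "\<lambda>_. UNIV"]) auto
  qed auto
  have "(\<Sum>h\<in>{..k} \<rightarrow>\<^sub>E UNIV. G h * of_bool (\<forall>l\<le>k. w l = h l)) =
      (\<Sum>h\<in>{..k} \<rightarrow>\<^sub>E UNIV. if h = restrict w {..k} then G h else 0)"
    by (intro sum.cong) (auto simp: iff)
  also have "\<dots> = G (restrict w {..k})"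
    using fin by simp
  also have "\<dots> = G w"
    by (intro assms) auto
  finally show ?thesis ..
qed

lemma markov_chain_path_event:
  assumes "markov_chain M \<omega> \<mu> p"
  shows "{s \<in> space M. \<forall>l\<le>k. \<omega> l s = h l} \<in> sets M"
    and "{s \<in> space M. (\<forall>l\<le>k. \<omega> l s = h l) \<and> \<omega> n s = j} \<in> sets M"
proof -
  have [measurable]: "\<omega> l \<in> measurable M (count_space UNIV)" for l
    using assms by (simp add: markov_chain_def)
  show "{s \<in> space M. \<forall>l\<le>k. \<omega> l s = h l} \<in> sets M"
    by measurable
  show "{s \<in> space M. (\<forall>l\<le>k. \<omega> l s = h l) \<and> \<omega> n s = j} \<in> sets M"
    by measurable
qed

text \<open>
  The transition rule in product form, which also holds when the past path has probability 0 and
  the conditional probabilities carry no information.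
\<close>

lemma markov_chain_path_step:
  assumes "markov_chain M \<omega> \<mu> p"
  shows "\<P>(s in M. (\<forall>l\<le>k. \<omega> l s = h l) \<and> \<omega> (Suc k) s = j) =
    \<P>(s in M. \<forall>l\<le>k. \<omega> l s = h l) * p (h k) j"
proof -
  interpret prob_space M
    using assms by (simp add: markov_chain_def)
  have [measurable]: "\<omega> l \<in> measurable M (count_space UNIV)" for l
    using assms by (simp add: markov_chain_def)
  note ev = markov_chain_path_event[OF assms]
  show ?thesis
  proof (cases "\<P>(s in M. \<forall>l\<le>k. \<omega> l s = h l) = 0")
    case True
    have "\<P>(s in M. (\<forall>l\<le>k. \<omega> l s = h l) \<and> \<omega> (Suc k) s = j) \<le> \<P>(s in M. \<forall>l\<le>k. \<omega> l s = h l)"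
      by (intro finite_measure_mono ev) auto
    with True show ?thesis
      by (simp add: measure_le_0_iff)
  next
    case False
    have "\<P>(s in M. \<forall>l\<le>k. \<omega> l s = h l) \<le> \<P>(s in M. \<omega> k s = h k)"
      by (intro finite_measure_mono) auto
    then have "\<P>(s in M. \<omega> k s = h k) \<noteq> 0"
      using False measure_nonneg[of M "{s \<in> space M. \<forall>l\<le>k. \<omega> l s = h l}"] by linarith
    then have "\<P>(s in M. \<omega> (Suc k) s = j \<bar> \<omega> k s = h k) = p (h k) j"
      using assms unfolding markov_chain_def by blast
    moreover have "\<P>(s in M. \<omega> (Suc k) s = j \<bar> \<forall>l\<le>k. \<omega> l s = h l) =
        \<P>(s in M. \<omega> (Suc k) s = j \<bar> \<omega> k s = h k)"
      using assms False unfolding markov_chain_def by blast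
    ultimately have "\<P>(s in M. \<omega> (Suc k) s = j \<bar> \<forall>l\<le>k. \<omega> l s = h l) = p (h k) j"
      by (rule trans[rotated])
    then show ?thesis
      using False by (simp add: cond_prob_def field_simps conj_commute)
  qed
qed

lemma integrable_path_function:
  fixes G :: "(nat \<Rightarrow> 'm::finite) \<Rightarrow> real"
  assumes mc: "markov_chain M \<omega> \<mu> p"
    and G: "\<And>w w'. (\<And>l. l \<le> k \<Longrightarrow> w l = w' l) \<Longrightarrow> G w = G w'"
  shows "integrable M (\<lambda>s. G (\<lambda>l. \<omega> l s))"
proof -
  interpret prob_space M
    using mc by (simp add: markov_chain_def)
  have [measurable]: "\<omega> l \<in> measurable M (count_space UNIV)" for l
    using mc by (simp add: markov_chain_def)
  have "G (\<lambda>l. \<omega> l s) = (\<Sum>h\<in>{..k} \<rightarrow>\<^sub>E UNIV. G h * of_bool (\<forall>l\<le>k. \<omega> l s = h l))" for s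
    by (rule path_function_expansion) (rule G)
  then show ?thesis
    by (simp only:)
      (intro Bochner_Integration.integrable_sum integrable_mult_right
        integrable_const_bound[of _ 1]; auto)
qed

text \<open>The Markov property, applied to a function of the modes up to time \<open>k\<close>.\<close>

lemma expectation_next_mode:
  fixes G :: "(nat \<Rightarrow> 'm::finite) \<Rightarrow> real"
  assumes mc: "markov_chain M \<omega> \<mu> p"
    and G: "\<And>w w'. (\<And>l. l \<le> k \<Longrightarrow> w l = w' l) \<Longrightarrow> G w = G w'"
  shows "(\<integral>s. G (\<lambda>l. \<omega> l s) * of_bool (\<omega> (Suc k) s = j) \<partial>M) =
    (\<integral>s. G (\<lambda>l. \<omega> l s) * p (\<omega> k s) j \<partial>M)"
proof -
  interpret prob_space M
    using mc by (simp add: markov_chain_def)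
  have [measurable]: "\<omega> l \<in> measurable M (count_space UNIV)" for l
    using mc by (simp add: markov_chain_def)
  have bool_integral: "(\<integral>s. of_bool (Q s) \<partial>M) = \<P>(s in M. Q s)" for Q
  proof -
    have "(\<integral>s. of_bool (Q s) \<partial>M) = (\<integral>s. indicator {s \<in> space M. Q s} s \<partial>M)"
      by (intro Bochner_Integration.integral_cong) (auto simp: indicator_def)
    also have "\<dots> = \<P>(s in M. Q s)"
      by (simp add: Int_absorb2)
    finally show ?thesis .
  qed
  have expand: "G (\<lambda>l. \<omega> l s) =
      (\<Sum>h\<in>{..k} \<rightarrow>\<^sub>E UNIV. G h * of_bool (\<forall>l\<le>k. \<omega> l s = h l))" for s
    by (rule path_function_expansion) (rule G)
  have "(\<integral>s. G (\<lambda>l. \<omega> l s) * of_bool (\<omega> (Suc k) s = j) \<partial>M) =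
      (\<integral>s. (\<Sum>h\<in>{..k} \<rightarrow>\<^sub>E UNIV. G h *
        of_bool ((\<forall>l\<le>k. \<omega> l s = h l) \<and> \<omega> (Suc k) s = j)) \<partial>M)"
    unfolding expand by (simp add: sum_distrib_right of_bool_conj mult.assoc)
  also have "\<dots> = (\<Sum>h\<in>{..k} \<rightarrow>\<^sub>E UNIV. G h *
      \<P>(s in M. (\<forall>l\<le>k. \<omega> l s = h l) \<and> \<omega> (Suc k) s = j))"
    unfolding bool_integral[symmetric]
    by (subst Bochner_Integration.integral_sum)
      (auto intro!: integrable_mult_right integrable_const_bound[of _ 1])
  also have "\<dots> = (\<Sum>h\<in>{..k} \<rightarrow>\<^sub>E UNIV. G h * p (h k) j * \<P>(s in M. \<forall>l\<le>k. \<omega> l s = h l))"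
    by (simp add: markov_chain_path_step[OF mc] mult_ac)
  also have "\<dots> = (\<integral>s. (\<Sum>h\<in>{..k} \<rightarrow>\<^sub>E UNIV. G h * p (h k) j *
      of_bool (\<forall>l\<le>k. \<omega> l s = h l)) \<partial>M)"
    unfolding bool_integral[symmetric]
    by (subst Bochner_Integration.integral_sum)
      (auto intro!: integrable_mult_right integrable_const_bound[of _ 1])
  also have "\<dots> = (\<integral>s. G (\<lambda>l. \<omega> l s) * p (\<omega> k s) j \<partial>M)"
  proof -
    have "G (\<lambda>l. \<omega> l s) * p (\<omega> k s) j =
        (\<Sum>h\<in>{..k} \<rightarrow>\<^sub>E UNIV. G h * p (h k) j * of_bool (\<forall>l\<le>k. \<omega> l s = h l))" for s
      by (rule path_function_expansion[of k "\<lambda>w. G w * p (w k) j"]) (metis G order_refl)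
    then show ?thesis
      by (simp only:)
  qed
  finally show ?thesis .
qed

lemma integrable_quad_state:
  assumes "markov_chain M \<omega> \<mu> p"
  shows "integrable M (\<lambda>s. quad (V (\<omega> k s)) (state \<phi> (\<lambda>l. \<omega> l s) x0 k))"
proof (rule integrable_path_function[OF assms, of k "\<lambda>w. quad (V (w k)) (state \<phi> w x0 k)"])
  fix w w' :: "nat \<Rightarrow> 'b"
  assume "\<And>l. l \<le> k \<Longrightarrow> w l = w' l"
  then show "quad (V (w k)) (state \<phi> w x0 k) = quad (V (w' k)) (state \<phi> w' x0 k)"
    using state_cong[of k w w' \<phi> x0] by simp
qed

lemma expectation_quad_step:
  fixes \<omega> :: "nat \<Rightarrow> 'a \<Rightarrow> 'm::finite"
  assumes mc: "markov_chain M \<omega> \<mu> p"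
  shows "(\<integral>s. quad (V (\<omega> (Suc k) s)) (state \<phi> (\<lambda>l. \<omega> l s) x0 (Suc k)) \<partial>M) =
    (\<integral>s. quad (lyap_op p \<phi> k V (\<omega> k s)) (state \<phi> (\<lambda>l. \<omega> l s) x0 k) \<partial>M)"
proof -
  define G where "G j w = quad (V j) (state \<phi> w x0 (Suc k))" for j w
  have G: "G j w = G j w'" if "\<And>l. l \<le> k \<Longrightarrow> w l = w' l" for j w w'
    using state_cong[of "Suc k" w w' \<phi> x0] that unfolding G_def by (simp add: less_Suc_eq_le)
  have int_next: "integrable M (\<lambda>s. G j (\<lambda>l. \<omega> l s) * of_bool (\<omega> (Suc k) s = j))" for j
    by (rule integrable_path_function[OF mc, of "Suc k" "\<lambda>w. G j w * of_bool (w (Suc k) = j)"])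
      (metis G le_Suc_eq)
  have int_avg: "integrable M (\<lambda>s. G j (\<lambda>l. \<omega> l s) * p (\<omega> k s) j)" for j
    by (rule integrable_path_function[OF mc, of k "\<lambda>w. G j w * p (w k) j"])
      (metis G order_refl)
  have "(\<integral>s. quad (V (\<omega> (Suc k) s)) (state \<phi> (\<lambda>l. \<omega> l s) x0 (Suc k)) \<partial>M) =
      (\<integral>s. (\<Sum>j\<in>UNIV. G j (\<lambda>l. \<omega> l s) * of_bool (\<omega> (Suc k) s = j)) \<partial>M)"
    by (simp add: G_def of_bool_def if_distrib cong: if_cong)
  also have "\<dots> = (\<Sum>j\<in>UNIV. \<integral>s. G j (\<lambda>l. \<omega> l s) * of_bool (\<omega> (Suc k) s = j) \<partial>M)"
    by (intro Bochner_Integration.integral_sum int_next)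
  also have "\<dots> = (\<Sum>j\<in>UNIV. \<integral>s. G j (\<lambda>l. \<omega> l s) * p (\<omega> k s) j \<partial>M)"
    by (intro sum.cong refl expectation_next_mode[OF mc] G)
  also have "\<dots> = (\<integral>s. (\<Sum>j\<in>UNIV. G j (\<lambda>l. \<omega> l s) * p (\<omega> k s) j) \<partial>M)"
    by (intro Bochner_Integration.integral_sum[symmetric] int_avg)
  also have "\<dots> = (\<integral>s. quad (lyap_op p \<phi> k V (\<omega> k s)) (state \<phi> (\<lambda>l. \<omega> l s) x0 k) \<partial>M)"
    by (simp add: quad_lyap_op G_def mult.commute)
  finally show ?thesis .
qed

lemma expectation_norm_propagated:
  assumes mc: "markov_chain M \<omega> \<mu> p"
  shows "(\<integral>s. (norm (state \<phi> (\<lambda>l. \<omega> l s) x0 (k + m)))\<^sup>2 \<partial>M) =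
    (\<integral>s. quad (propagated p \<phi> m k (\<omega> k s)) (state \<phi> (\<lambda>l. \<omega> l s) x0 k) \<partial>M)"
proof (induction m arbitrary: k)
  case (Suc m)
  show ?case
    using Suc[of "Suc k"] expectation_quad_step[OF mc, of "propagated p \<phi> m (Suc k)" k] by simp
qed simp

lemma expectation_norm_point_mass:
  assumes mc: "markov_chain M \<omega> (return_pmf i) p"
  shows "(\<integral>s. (norm (state \<phi> (\<lambda>l. \<omega> l s) x0 m))\<^sup>2 \<partial>M) = quad (propagated p \<phi> m 0 i) x0"
proof -
  interpret prob_space M
    using mc by (simp add: markov_chain_def)
  have [measurable]: "\<omega> l \<in> measurable M (count_space UNIV)" for l
    using mc by (simp add: markov_chain_def)
  have "\<P>(s in M. \<omega> 0 s = i) = 1"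
    using mc by (simp add: markov_chain_def)
  then have "AE s in M. \<omega> 0 s = i"
    by (subst (asm) prob_Collect_eq_1) auto
  then have "(\<integral>s. quad (propagated p \<phi> m 0 (\<omega> 0 s)) x0 \<partial>M) =
      (\<integral>s. quad (propagated p \<phi> m 0 i) x0 \<partial>M)"
    by (intro integral_cong_AE) auto
  then show ?thesis
    using expectation_norm_propagated[OF mc, of \<phi> x0 0 m] by (simp add: prob_space)
qed

section \<open>Periodic Lyapunov inequalities and mean square stability\<close>

lemma periodic_mod:
  fixes P :: "nat \<Rightarrow> 'b"
  assumes "\<And>k. P (k + T) = P k"
  shows "P k = P (k mod T)"
proof -
  have "P (r + q * T) = P r" for q r
    by (induction q) (simp_all add: assms flip: add.assoc add: add.commute[of T])
  from this[of "k mod T" "k div T"] show ?thesis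
    by simp
qed

lemma periodic_contraction_tendsto_0:
  fixes a :: "nat \<Rightarrow> real"
  assumes "1 \<le> T" and nonneg: "\<And>k. 0 \<le> a k" and \<rho>: "0 \<le> \<rho>" "\<rho> < 1"
    and contr: "\<And>k. a (k + T) \<le> \<rho> * a k"
  shows "a \<longlonglongrightarrow> 0"
proof -
  have iter: "a (r + q * T) \<le> \<rho> ^ q * a r" for r q
  proof (induction q)
    case (Suc q)
    have "a (r + Suc q * T) \<le> \<rho> * a (r + q * T)"
      using contr[of "r + q * T"] by (simp add: algebra_simps)
    also have "\<dots> \<le> \<rho> * (\<rho> ^ q * a r)"
      using Suc \<rho> by (intro mult_left_mono)
    finally show ?case
      by (simp add: mult.assoc)
  qed simp
  define C where "C = (\<Sum>r<T. a r)"
  have bound: "a k \<le> \<rho> ^ (k div T) * C" for k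
  proof -
    have "a k \<le> \<rho> ^ (k div T) * a (k mod T)"
      using iter[of "k mod T" "k div T"] by simp
    also have "\<dots> \<le> \<rho> ^ (k div T) * C"
      unfolding C_def using \<rho> \<open>1 \<le> T\<close> nonneg by (intro mult_left_mono member_le_sum) auto
    finally show ?thesis .
  qed
  have "filterlim (\<lambda>k. k div T) at_top sequentially"
    unfolding filterlim_at_top
  proof
    fix Z
    show "\<forall>\<^sub>F k in sequentially. Z \<le> k div T"
      using eventually_ge_at_top[of "Z * T"]
      by eventually_elim (use \<open>1 \<le> T\<close> in \<open>simp add: less_eq_div_iff_mult_less_eq\<close>)
  qed
  then have "(\<lambda>k. \<rho> ^ (k div T)) \<longlonglongrightarrow> 0"
    using \<rho> by (intro filterlim_compose[OF LIMSEQ_realpow_zero[of \<rho>]]) auto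
  then have "(\<lambda>k. \<rho> ^ (k div T) * C) \<longlonglongrightarrow> 0"
    by (rule tendsto_mult_left_zero)
  then show ?thesis
    by (rule tendsto_sandwich[of "\<lambda>_. 0", rotated 3]) (auto simp: nonneg bound)
qed

lemma lyapunov_imp_mean_square_stable:
  fixes M :: "'m::finite pmf \<Rightarrow> 'a measure" and P :: "nat \<Rightarrow> 'm \<Rightarrow> real^'n^'n"
  assumes "1 \<le> T"
    and mc: "\<And>\<mu>. markov_chain (M \<mu>) \<omega> \<mu> p"
    and per: "\<And>k i. \<phi> (k + T) i = \<phi> k i" "\<And>k. P (k + T) = P k"
    and \<nu>: "\<And>k. k < T \<Longrightarrow> 0 < \<nu> k" "(\<Prod>k<T. \<nu> k) < 1"
    and pd: "\<And>k i. pos_def (P k i)"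
    and ineq: "\<And>k i. k < T \<Longrightarrow> pos_semidef (\<nu> k *\<^sub>R P k i - lyap_op p \<phi> k (P (Suc k)) i)"
  shows "mean_square_stable M \<omega> \<phi>"
  unfolding mean_square_stable_def
proof (intro allI)
  fix x0 :: "real^'n" and \<mu> :: "'m pmf"
  define x where "x k s = state \<phi> (\<lambda>l. \<omega> l s) x0 k" for k s
  define a where "a k = (\<integral>s. quad (P k (\<omega> k s)) (x k s) \<partial>M \<mu>)" for k
  have nonneg: "0 \<le> quad (P k i) v" for k i v
    using pd[of k i] by (cases "v = 0") (auto simp: pos_def_def quad_def intro: less_imp_le)
  have a_nonneg: "0 \<le> a k" for k
    unfolding a_def by (intro Bochner_Integration.integral_nonneg nonneg)
  have quad_step: "quad (lyap_op p \<phi> k (P (Suc k)) i) v \<le> \<nu> (k mod T) * quad (P k i) v" for k i v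
  proof -
    have "\<phi> (k mod T) = \<phi> k"
      by (rule periodic_mod[symmetric]) (simp add: per(1) fun_eq_iff)
    moreover have "P (k mod T) = P k"
      by (rule periodic_mod[symmetric]) (rule per(2))
    moreover have "P (Suc (k mod T)) = P (Suc k)"
      by (rule periodic_mod[of "\<lambda>k. P (Suc k)", symmetric]) (use per(2)[of "Suc _"] in simp)
    ultimately have "pos_semidef (\<nu> (k mod T) *\<^sub>R P k i - lyap_op p \<phi> k (P (Suc k)) i)"
      using ineq[of "k mod T" i] \<open>1 \<le> T\<close> by (simp add: lyap_op_def)
    then have "0 \<le> quad (\<nu> (k mod T) *\<^sub>R P k i - lyap_op p \<phi> k (P (Suc k)) i) v"
      by (simp add: pos_semidef_def quad_def)
    then show ?thesis
      by (simp add: quad_diff)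
  qed
  have a_step: "a (Suc k) \<le> \<nu> (k mod T) * a k" for k
  proof -
    have "a (Suc k) = (\<integral>s. quad (lyap_op p \<phi> k (P (Suc k)) (\<omega> k s)) (x k s) \<partial>M \<mu>)"
      unfolding a_def x_def by (rule expectation_quad_step[OF mc])
    also have "\<dots> \<le> (\<integral>s. \<nu> (k mod T) * quad (P k (\<omega> k s)) (x k s) \<partial>M \<mu>)"
      unfolding x_def
      by (intro integral_mono integrable_mult_right integrable_quad_state[OF mc] quad_step)
    finally show ?thesis
      by (simp add: a_def)
  qed
  have a_steps: "a (k + m) \<le> (\<Prod>l<m. \<nu> ((k + l) mod T)) * a k" for k m
  proof (induction m)
    case (Suc m)
    have "a (k + Suc m) \<le> \<nu> ((k + m) mod T) * a (k + m)"
      using a_step[of "k + m"] by simp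
    also have "\<dots> \<le> \<nu> ((k + m) mod T) * ((\<Prod>l<m. \<nu> ((k + l) mod T)) * a k)"
      using Suc \<nu>(1)[of "(k + m) mod T"] \<open>1 \<le> T\<close> by (intro mult_left_mono) auto
    finally show ?case
      by (simp add: mult_ac)
  qed simp
  \<comment> \<open>One period contributes the same product whatever its starting time.\<close>
  have shift: "(\<Prod>l<T. \<nu> ((k + l) mod T)) = (\<Prod>l<T. \<nu> l)" for k
  proof (induction k)
    case 0
    show ?case
      by (intro prod.cong) auto
  next
    case (Suc k)
    obtain T' where T': "T = Suc T'"
      using \<open>1 \<le> T\<close> by (cases T) auto
    have "(\<Prod>l<T. \<nu> ((Suc k + l) mod T)) = (\<Prod>l<T'. \<nu> ((k + Suc l) mod T)) * \<nu> ((k + T) mod T)"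
      by (simp add: T' prod.lessThan_Suc del: mod_add_self2)
    also have "\<dots> = (\<Prod>l<T'. \<nu> ((k + Suc l) mod T)) * \<nu> (k mod T)"
      by simp
    also have "\<dots> = (\<Prod>l<T. \<nu> ((k + l) mod T))"
      by (subst (2) T') (simp add: prod.lessThan_Suc_shift mult.commute del: prod.lessThan_Suc)
    finally show ?case
      using Suc by simp
  qed
  have "a \<longlonglongrightarrow> 0"
  proof (rule periodic_contraction_tendsto_0[OF \<open>1 \<le> T\<close> a_nonneg _ \<nu>(2)])
    show "0 \<le> (\<Prod>k<T. \<nu> k)"
      using \<nu>(1) by (intro prod_nonneg) (auto intro: less_imp_le)
    show "a (k + T) \<le> (\<Prod>k<T. \<nu> k) * a k" for k
      using a_steps[of k T] by (simp add: shift)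
  qed
  have "\<exists>c. \<forall>k i. 0 < c k i \<and> (\<forall>v. c k i * (norm v)\<^sup>2 \<le> quad (P k i) v)"
    by (intro choice allI) (metis pd pos_def_lower_bound)
  then obtain c where c: "\<And>k i. 0 < c k i" "\<And>k i v. c k i * (norm v)\<^sup>2 \<le> quad (P k i) v"
    by metis
  define d where "d = Min ((\<lambda>(k, i). c k i) ` ({..<T} \<times> UNIV))"
  have ne: "{..<T} \<times> (UNIV :: 'm set) \<noteq> {}"
    using \<open>1 \<le> T\<close> by (auto simp: lessThan_empty_iff)
  have "0 < d"
    unfolding d_def using ne c(1) by (subst Min_gr_iff) auto
  have d: "d * (norm v)\<^sup>2 \<le> quad (P k i) v" for k i v
  proof -
    have "d \<le> c (k mod T) i"
      unfolding d_def using \<open>1 \<le> T\<close> by (intro Min_le) (auto intro!: image_eqI[of _ _ "(k mod T, i)"])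
    then have "d * (norm v)\<^sup>2 \<le> c (k mod T) i * (norm v)\<^sup>2"
      by (intro mult_right_mono) auto
    also have "\<dots> \<le> quad (P (k mod T) i) v"
      by (rule c(2))
    finally show ?thesis
      using periodic_mod[of P T k] per(2) by simp
  qed
  have bound: "(\<integral>s. (norm (x k s))\<^sup>2 \<partial>M \<mu>) \<le> a k / d" for k
  proof -
    have "(\<integral>s. (norm (x k s))\<^sup>2 \<partial>M \<mu>) \<le> (\<integral>s. quad (P k (\<omega> k s)) (x k s) / d \<partial>M \<mu>)"
    proof (intro integral_mono)
      show "integrable (M \<mu>) (\<lambda>s. (norm (x k s))\<^sup>2)"
        using integrable_quad_state[OF mc, of \<mu> "\<lambda>_. mat 1" k \<phi> x0] by (simp add: x_def)
      show "integrable (M \<mu>) (\<lambda>s. quad (P k (\<omega> k s)) (x k s) / d)"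
        unfolding x_def by (intro integrable_divide integrable_quad_state[OF mc])
      show "(norm (x k s))\<^sup>2 \<le> quad (P k (\<omega> k s)) (x k s) / d" for s
        using d[of "x k s" k "\<omega> k s"] \<open>0 < d\<close> by (simp add: field_simps)
    qed
    then show ?thesis
      by (simp add: a_def)
  qed
  have "(\<lambda>k. a k / d) \<longlonglongrightarrow> 0"
    using \<open>a \<longlonglongrightarrow> 0\<close> by (rule tendsto_divide_zero)
  then have "(\<lambda>k. \<integral>s. (norm (x k s))\<^sup>2 \<partial>M \<mu>) \<longlonglongrightarrow> 0"
    by (rule Lim_null_comparison[rotated]) (simp add: bound)
  then show "(\<lambda>k. \<integral>s. (norm (state \<phi> (\<lambda>l. \<omega> l s) x0 k))\<^sup>2 \<partial>M \<mu>) \<longlonglongrightarrow> 0"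
    by (simp add: x_def)
qed

lemma mean_square_stable_imp_lyapunov:
  fixes M :: "'m::finite pmf \<Rightarrow> 'a measure" and \<phi> :: "nat \<Rightarrow> 'm \<Rightarrow> real^'n^'n"
  assumes "stochastic p"
    and mc: "\<And>\<mu>. markov_chain (M \<mu>) \<omega> \<mu> p"
    and per: "\<And>k i. \<phi> (k + T) i = \<phi> k i"
    and mss: "mean_square_stable M \<omega> \<phi>"
  obtains P :: "nat \<Rightarrow> 'm \<Rightarrow> real^'n^'n" and \<gamma> where
    "1 < \<gamma>" "\<And>k. P (k + T) = P k" "\<And>k i. pos_def (P k i)"
    "\<And>k i. k < T \<Longrightarrow> pos_semidef ((1 / \<gamma>) *\<^sub>R P k i - lyap_op p \<phi> k (P (Suc k)) i)"
proof -
  let ?W = "propagated p \<phi>"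
  have "(\<lambda>k. \<integral>s. (norm (state \<phi> (\<lambda>l. \<omega> l s) v k))\<^sup>2 \<partial>M (return_pmf i)) \<longlonglongrightarrow> 0" for i v
    using mss by (simp add: mean_square_stable_def)
  then have "(\<lambda>m. quad (?W m 0 i) v) \<longlonglongrightarrow> 0" for i v
    by (simp add: expectation_norm_point_mass[OF mc])
  then have "\<forall>\<^sub>F m in sequentially. \<forall>k\<in>{..<T}. \<forall>i v. quad (?W m k i) v \<le> 1/2 * (norm v)\<^sup>2"
    by (intro eventually_ball_finite ballI eventually_all_finite
        propagated_eventually_small[where T = T and p = p and \<phi> = \<phi>] \<open>stochastic p\<close> per) auto
  then have "\<forall>\<^sub>F m in sequentially. 1 \<le> m \<and>
      (\<forall>k\<in>{..<T}. \<forall>i v. quad (?W m k i) v \<le> 1/2 * (norm v)\<^sup>2)"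
    using eventually_ge_at_top[of "1::nat"] by eventually_elim auto
  then obtain K where K: "1 \<le> K"
      "\<And>k i v. k < T \<Longrightarrow> quad (?W K k i) v \<le> 1/2 * (norm v)\<^sup>2"
    unfolding eventually_sequentially by auto
  \<comment> \<open>This choice makes \<open>\<gamma> ^ K\<close> cancel the factor 1/2 gained over the horizon \<open>K\<close>.\<close>
  define \<gamma> :: real where "\<gamma> = root K 2"
  have "1 < \<gamma>" "\<gamma> ^ K = 2"
    using K(1) by (auto simp: \<gamma>_def)
  define P where "P k i = (\<Sum>m<K. \<gamma> ^ m *\<^sub>R ?W m k i)" for k i
  have sym: "transpose (P k i) = P k i" for k i
    by (simp add: P_def transpose_sum transpose_scaleR transpose_propagated)
  have quad_P: "quad (P k i) v = (\<Sum>m<K. \<gamma> ^ m * quad (?W m k i) v)" for k i v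
    by (simp add: P_def quad_sum)
  have ge: "(norm v)\<^sup>2 \<le> quad (P k i) v" for k i v
  proof -
    have "\<gamma> ^ 0 * quad (?W 0 k i) v \<le> quad (P k i) v"
      unfolding quad_P using K(1) \<open>1 < \<gamma>\<close>
      by (intro member_le_sum[where f = "\<lambda>m. \<gamma> ^ m * quad (?W m k i) v"] mult_nonneg_nonneg
          quad_propagated_nonneg \<open>stochastic p\<close>) auto
    then show ?thesis
      by simp
  qed
  show thesis
  proof
    show "1 < \<gamma>" by fact
    show "P (k + T) = P k" for k
      by (simp add: P_def fun_eq_iff propagated_periodic[of \<phi> T, OF per])
    show "pos_def (P k i)" for k i
      unfolding pos_def_def
    proof (intro conjI allI impI sym)
      fix v :: "real^'n"
      assume "v \<noteq> 0"
      then have "0 < (norm v)\<^sup>2"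
        by simp
      then show "0 < v \<bullet> (P k i *v v)"
        using ge[of v k i] unfolding quad_def by (rule less_le_trans)
    qed
    show "pos_semidef ((1 / \<gamma>) *\<^sub>R P k i - lyap_op p \<phi> k (P (Suc k)) i)" if "k < T" for k i
      unfolding pos_semidef_def
    proof (intro conjI allI)
      show "transpose ((1 / \<gamma>) *\<^sub>R P k i - lyap_op p \<phi> k (P (Suc k)) i) =
          (1 / \<gamma>) *\<^sub>R P k i - lyap_op p \<phi> k (P (Suc k)) i"
        by (simp add: transpose_diff transpose_scaleR transpose_lyap_op sym)
      fix v :: "real^'n"
      let ?w = "\<lambda>m. \<gamma> ^ m * quad (?W m k i) v"
      have "quad (lyap_op p \<phi> k (P (Suc k)) i) v =
          (\<Sum>j\<in>UNIV. \<Sum>m<K. \<gamma> ^ m * (p i j * quad (?W m (Suc k) j) (\<phi> k i *v v)))"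
        by (simp add: quad_lyap_op quad_P sum_distrib_left mult_ac)
      also have "\<dots> = (\<Sum>m<K. \<gamma> ^ m * quad (?W (Suc m) k i) v)"
        by (subst sum.swap) (simp add: quad_lyap_op sum_distrib_left)
      finally have "\<gamma> * quad (lyap_op p \<phi> k (P (Suc k)) i) v = (\<Sum>m<K. ?w (Suc m))"
        by (simp add: sum_distrib_left mult.assoc)
      also have "\<dots> = (\<Sum>m<K. ?w m) + ?w K - ?w 0"
        using sum.lessThan_Suc_shift[of ?w K] by simp
      also have "\<dots> \<le> quad (P k i) v"
        using K(2)[OF that, of i v] by (simp add: quad_P \<open>\<gamma> ^ K = 2\<close>)
      finally have "0 \<le> quad ((1 / \<gamma>) *\<^sub>R P k i - lyap_op p \<phi> k (P (Suc k)) i) v"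
        using \<open>1 < \<gamma>\<close> by (simp add: quad_diff field_simps)
      then show "0 \<le> v \<bullet> (((1 / \<gamma>) *\<^sub>R P k i - lyap_op p \<phi> k (P (Suc k)) i) *v v)"
        by (simp add: quad_def)
    qed
  qed
qed

theorem theorem5:
  fixes M :: "'m::finite pmf \<Rightarrow> 'a measure"
    and \<omega> :: "nat \<Rightarrow> 'a \<Rightarrow> 'm"
    and p :: "'m \<Rightarrow> 'm \<Rightarrow> real"
    and \<phi> :: "nat \<Rightarrow> 'm \<Rightarrow> real^'n^'n"
    and T :: nat
  assumes "T \<ge> 1"
    and "stochastic p"
    and "\<And>\<mu>. markov_chain (M \<mu>) \<omega> \<mu> p"
    and "\<And>k i. \<phi> (k + T) i = \<phi> k i"
  shows "mean_square_stable M \<omega> \<phi> \<longleftrightarrow>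
    (\<exists>(P :: nat \<Rightarrow> 'm \<Rightarrow> real^'n^'n) (\<nu> :: nat \<Rightarrow> real).
       (\<forall>k. P (k + T) = P k) \<and>
       (\<forall>k<T. 0 < \<nu> k) \<and>
       (\<forall>k i. pos_def (P k i)) \<and>
       (\<forall>k<T. \<forall>i. pos_semidef (\<nu> k *\<^sub>R P k i - lyap_op p \<phi> k (P (Suc k)) i)) \<and>
       (\<Prod>k<T. \<nu> k) < 1)"
proof
  assume "mean_square_stable M \<omega> \<phi>"
  with assms obtain P :: "nat \<Rightarrow> 'm \<Rightarrow> real^'n^'n" and \<gamma> where
    "1 < \<gamma>" "\<And>k. P (k + T) = P k" "\<And>k i. pos_def (P k i)"
    "\<And>k i. k < T \<Longrightarrow> pos_semidef ((1 / \<gamma>) *\<^sub>R P k i - lyap_op p \<phi> k (P (Suc k)) i)"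
    by (elim mean_square_stable_imp_lyapunov[rotated 3]) auto
  moreover from \<open>1 < \<gamma>\<close> \<open>T \<ge> 1\<close> have "(\<Prod>k<T. 1 / \<gamma>) < 1"
    by (simp add: power_one_over power_less_one_iff one_less_power)
  ultimately show "\<exists>(P :: nat \<Rightarrow> 'm \<Rightarrow> real^'n^'n) (\<nu> :: nat \<Rightarrow> real).
       (\<forall>k. P (k + T) = P k) \<and>
       (\<forall>k<T. 0 < \<nu> k) \<and>
       (\<forall>k i. pos_def (P k i)) \<and>
       (\<forall>k<T. \<forall>i. pos_semidef (\<nu> k *\<^sub>R P k i - lyap_op p \<phi> k (P (Suc k)) i)) \<and>
       (\<Prod>k<T. \<nu> k) < 1"
    by (intro exI[of _ P] exI[of _ "\<lambda>_. 1 / \<gamma>"]) auto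
next
  assume "\<exists>(P :: nat \<Rightarrow> 'm \<Rightarrow> real^'n^'n) (\<nu> :: nat \<Rightarrow> real).
       (\<forall>k. P (k + T) = P k) \<and>
       (\<forall>k<T. 0 < \<nu> k) \<and>
       (\<forall>k i. pos_def (P k i)) \<and>
       (\<forall>k<T. \<forall>i. pos_semidef (\<nu> k *\<^sub>R P k i - lyap_op p \<phi> k (P (Suc k)) i)) \<and>
       (\<Prod>k<T. \<nu> k) < 1"
  then obtain P :: "nat \<Rightarrow> 'm \<Rightarrow> real^'n^'n" and \<nu> :: "nat \<Rightarrow> real" where
      "\<And>k. P (k + T) = P k" "\<And>k. k < T \<Longrightarrow> 0 < \<nu> k" "\<And>k i. pos_def (P k i)"
      "\<And>k i. k < T \<Longrightarrow> pos_semidef (\<nu> k *\<^sub>R P k i - lyap_op p \<phi> k (P (Suc k)) i)"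
      "(\<Prod>k<T. \<nu> k) < 1"
    by blast
  then show "mean_square_stable M \<omega> \<phi>"
    using assms by (intro lyapunov_imp_mean_square_stable[where P = P and \<nu> = \<nu> and T = T and p = p])
qed

end
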